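(* Let $T\subset\mathbb{R}^3$ be a non-degenerate tetrahedron, $k\ge1$, and let $F$ be a face of $T$ with normal $\mathbf{n}$. Let $U\in\Pi_k(T;\mathbb{R}^{3\times3})$ be such that the following degrees of freedom corresponding to $F$ are zero. (1a), (1b) For each vertex $V$ of $F$: $U(V)_{ij}=0$ for all $i\neq j$, $U(V)_{11}-U(V)_{22}=0$ and $U(V)_{22}-U(V)_{33}=0$. (2a), (2b) If $k\ge2$, for each edge $E$ of $F$ and each inner Lagrange point $L$ on $E$: $\mathbf{n}_{E,1}^TU(L)\mathbf{t}_E=0$ and $\mathbf{n}_{E,2}^TU(L)\mathbf{t}_E=0$, and $$\mathbf{t}_E^TU(L)(\mathbf{n}\times\mathbf{t}_E)=0,\qquad \mathbf{n}^TU(L)(\mathbf{n}\times\mathbf{t}_E)=0,\qquad \mathbf{t}_E^TU(L)(\mathbf{n}\times\boldsymbol{\partial})+\boldsymbol{\partial}^TU(L)(\mathbf{n}\times\mathbf{t}_E)=0,$$ where $\boldsymbol{\partial}:=\mathbf{t}_E\times\mathbf{n}$. (3a) If $k\ge3$, for each inner Lagrange point $L$ of $F$: $$\mathbf{a}_1^TU(L)(\mathbf{n}\times\mathbf{a}_1)=0,\quad \mathbf{a}_2^TU(L)(\mathbf{n}\times\mathbf{a}_2)=0,\quad \mathbf{a}_1^TU(L)(\mathbf{n}\times\mathbf{a}_2)+\mathbf{a}_2^TU(L)(\mathbf{n}\times\mathbf{a}_1)=0,$$ $$\mathbf{n}^TU(L)(\mathbf{n}\times\mathbf{a}_1)=0,\quad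 \mathbf{n}^TU(L)(\mathbf{n}\times\mathbf{a}_2)=0.$$ Then $\operatorname{sym}(U\operatorname{Anti}\mathbf{n})=0$ on $F$.
   Context: $\Pi_k(T;\mathbb{R}^{3\times3})$ is the space of $\mathbb{R}^{3\times3}$-valued polynomials of (total) degree $k$ or less on $T$. Lagrange points on $T$ are the usual ones: the points with barycentric coordinates in $\frac1k\mathbb{Z}_{\ge 0}$ with respect to $T$; an inner Lagrange point of an edge or face is one in its relative interior. The normal $\mathbf{n}$ of $F$ is a unit vector. Each edge $E$ has a fixed unit tangent $\mathbf{t}_E$ and two fixed unit vectors $\mathbf{n}_{E,1},\mathbf{n}_{E,2}$ that span the plane orthogonal to $E$. The vectors $\mathbf{a}_1,\mathbf{a}_2\in\mathbb{R}^3$ are fixed for $F$ and such that $\mathbf{a}_1,\mathbf{a}_2,\mathbf{n}$ are linearly independent. $\operatorname{sym}A:=\frac12(A+A^T)$, and for $\mathbf{a}\in\mathbb{R}^3$, $\operatorname{Anti}\mathbf{a}:=\begin{pmatrix} 0 & -a_3 & a_2 \\ a_3 & 0 & -a_1 \\ -a_2 & a_1 & 0 \end{pmatrix}$, so that $(\operatorname{Anti}\mathbf{a})\mathbf{b}=\mathbf{a}\times\mathbf{b}$. *)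

theory Defs
  imports "HOL-Analysis.Analysis"
begin

text \<open>Exponents of the monomials of total degree at most \<open>k\<close> in three variables.\<close>

definition multi_indices :: "nat \<Rightarrow> (3 \<Rightarrow> nat) set" where
  "multi_indices k = {\<alpha>. (\<Sum>l\<in>UNIV. \<alpha> l) \<le> k}"

lemma finite_multi_indices: "finite (multi_indices k)"
proof (rule finite_subset)
  show "multi_indices k \<subseteq> (UNIV :: 3 set) \<rightarrow>\<^sub>E {..k}"
  proof
    fix \<alpha> assume "\<alpha> \<in> multi_indices k"
    moreover have "\<alpha> l \<le> (\<Sum>l\<in>UNIV. \<alpha> l)" for l
      by (rule member_le_sum) auto
    ultimately show "\<alpha> \<in> UNIV \<rightarrow>\<^sub>E {..k}"
      using order_trans by (fastforce simp: multi_indices_def)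
  qed
qed (auto intro: finite_PiE)

text \<open>Membership constrains the values on \<open>T\<close> only.\<close>

definition matrix_polys :: "nat \<Rightarrow> (real^3) set \<Rightarrow> (real^3 \<Rightarrow> real^3^3) set" where
  "matrix_polys k T = {U. \<forall>i j. \<exists>c. \<forall>x\<in>T.
     U x $ i $ j = (\<Sum>\<alpha>\<in>multi_indices k. c \<alpha> * (\<Prod>l\<in>UNIV. (x $ l) ^ \<alpha> l))}"

text \<open>For a simplex \<open>T\<close> the extreme points are the vertices, and \<open>u v\<close> is the barycentric
  coordinate with respect to the vertex \<open>v\<close>.\<close>

definition lagrange_points :: "nat \<Rightarrow> (real^3) set \<Rightarrow> (real^3) set" where
  "lagrange_points k T = {L. \<exists>u.
     (\<forall>v. v extreme_point_of T \<longrightarrow> (\<exists>m::nat. u v = real m / real k)) \<and>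
     (\<Sum>v | v extreme_point_of T. u v) = 1 \<and>
     (\<Sum>v | v extreme_point_of T. u v *\<^sub>R v) = L}"

text \<open>\<open>S\<close> is an edge or a face of \<open>T\<close>; the barycentric coordinates are those with respect to \<open>T\<close>.\<close>

definition inner_lagrange_points :: "nat \<Rightarrow> (real^3) set \<Rightarrow> (real^3) set \<Rightarrow> (real^3) set" where
  "inner_lagrange_points k T S = lagrange_points k T \<inter> rel_interior S"

definition orthogonal_space :: "(real^3) set \<Rightarrow> (real^3) set" where
  "orthogonal_space S = {w. \<forall>x\<in>S. \<forall>y\<in>S. w \<bullet> (x - y) = 0}"

definition tangent_space :: "(real^3) set \<Rightarrow> (real^3) set" where
  "tangent_space S = span {x - y | x y. x \<in> S \<and> y \<in> S}"

definition sym_part :: "real^3^3 \<Rightarrow> real^3^3" where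
  "sym_part A = (1/2) *\<^sub>R (A + transpose A)"

definition Anti :: "real^3 \<Rightarrow> real^3^3" where
  "Anti a = vector [vector [0, - a$3, a$2],
                    vector [a$3, 0, - a$1],
                    vector [- a$2, a$1, 0]]"

lemma Anti_mult_vec: "Anti a *v b = cross3 a b"
  by (simp add: Anti_def cross3_def matrix_vector_mult_def vec_eq_iff forall_3 sum_3)

end

theory Submission
  imports Defs "HOL-Computational_Algebra.Polynomial"
begin

text \<open>
  The symmetric part of \<open>U Anti n\<close> represents the quadratic form \<open>v \<mapsto> v \<bullet> U (n \<times> v)\<close>, whose
  polarisation pairs \<open>v\<close> with \<open>w\<close> to \<open>v \<bullet> U (n \<times> w) + w \<bullet> U (n \<times> v)\<close>.  So it vanishes once the
  form and its polarisation vanish on a basis.  If \<open>n\<close> is one of the three basis vectors, its own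
  diagonal term is zero because \<open>n \<times> n = 0\<close>, and five conditions remain.

  At each kind of Lagrange point of \<open>F\<close> the degrees of freedom amount to these conditions.  At an
  inner point of \<open>F\<close> the basis is \<open>a1, a2, n\<close> and they are stated literally.  At an inner point
  of an edge the basis is \<open>t, d, n\<close> with \<open>d = t \<times> n\<close>: the values at \<open>(t, t)\<close>, \<open>(t, n)\<close> and
  \<open>(t, d)\<close> are stated, and since \<open>n \<times> d = t\<close> the other two, at \<open>(d, d)\<close> and \<open>(d, n)\<close>, vanish
  because \<open>U t\<close> has no component orthogonal to the edge.  At a vertex \<open>U\<close> is a multiple of the
  identity, and \<open>v\<close> is orthogonal to \<open>n \<times> v\<close>
  (lemmas \<open>sym_part_mult_Anti_eq_0_basis\<close>, \<open>sym_part_mult_Anti_eq_0_edge\<close> and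
  \<open>sym_part_mult_Anti_eq_0_scalar\<close>).

  Hence the entries of \<open>sym (U Anti n)\<close>, which are polynomials of degree at most \<open>k\<close> on the
  triangle \<open>F\<close>, vanish at all points of its lattice of order \<open>k\<close>.  Such a polynomial is zero
  (\<open>bipoly_unisolvence\<close>): on one side of the lattice it has more zeros than its degree, so it
  vanishes on that line, the linear equation of the line divides it, and the quotient has degree
  at most \<open>k - 1\<close> and vanishes on the remaining lattice of order \<open>k - 1\<close>.  What is left is geometry: every point of the lattice
  is an inner Lagrange point of the vertex, edge or face that is spanned by the vertices with
  positive weight (\<open>lattice_point_of_face\<close>).
\<close>

section \<open>The quadratic form of a matrix times a cross product\<close>

lemma sym_part_eq_0I:
  assumes "\<And>v. v \<bullet> (A *v v) = 0"
  shows "sym_part A = 0"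
proof -
  have entry: "axis i 1 \<bullet> (A *v axis j 1) = A $ i $ j" for i j
    by (simp add: inner_axis' matrix_vector_mult_basis column_def)
  have "A $ i $ j + A $ j $ i = 0" for i j
    using assms[of "axis i 1 + axis j 1"] assms[of "axis i 1"] assms[of "axis j 1"]
    by (simp add: matrix_vector_right_distrib inner_add_left inner_add_right entry)
  then show ?thesis
    by (simp add: sym_part_def vec_eq_iff transpose_def)
qed

lemma sym_part_mult_Anti_eq_0I:
  assumes "\<And>v. v \<bullet> (A *v cross3 n v) = 0"
  shows "sym_part (A ** Anti n) = 0"
  using assms by (intro sym_part_eq_0I) (simp flip: matrix_vector_mul_assoc add: Anti_mult_vec)

text \<open>Polarisation.  As \<open>n \<times> n = 0\<close>, the coordinate of \<open>v\<close> along \<open>n\<close> drops out of \<open>n \<times> v\<close>, so of the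
  six entries of the form in this basis five remain, one for each equation assumed.\<close>

lemma sym_part_mult_Anti_eq_0_basis:
  assumes "span {a, b, n} = UNIV"
    and "a \<bullet> (A *v cross3 n a) = 0" "b \<bullet> (A *v cross3 n b) = 0"
    and "a \<bullet> (A *v cross3 n b) + b \<bullet> (A *v cross3 n a) = 0"
    and "n \<bullet> (A *v cross3 n a) = 0" "n \<bullet> (A *v cross3 n b) = 0"
  shows "sym_part (A ** Anti n) = 0"
proof (rule sym_part_mult_Anti_eq_0I)
  fix v
  have "v \<in> span {a, b, n}"
    using assms(1) by simp
  then obtain x y z where "v - x *\<^sub>R a - y *\<^sub>R b = z *\<^sub>R n"
    by (auto simp: span_insert span_breakdown_eq)
  then have v: "v = x *\<^sub>R a + y *\<^sub>R b + z *\<^sub>R n"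
    by (simp add: algebra_simps)
  have cross: "cross3 n v = x *\<^sub>R cross3 n a + y *\<^sub>R cross3 n b"
    by (simp add: v Cross3.cross_add_right Cross3.cross_mult_right)
  have "v \<bullet> (A *v cross3 n v) =
      x * x * (a \<bullet> (A *v cross3 n a)) + y * y * (b \<bullet> (A *v cross3 n b))
      + x * y * (a \<bullet> (A *v cross3 n b) + b \<bullet> (A *v cross3 n a))
      + z * x * (n \<bullet> (A *v cross3 n a)) + z * y * (n \<bullet> (A *v cross3 n b))"
    unfolding cross
    by (simp add: v matrix_vector_right_distrib matrix_vector_mult_scaleR inner_add_left
        inner_add_right algebra_simps)
  then show "v \<bullet> (A *v cross3 n v) = 0"
    using assms by simp
qed

lemma sym_part_mult_Anti_eq_0_scalar:
  assumes "\<And>i j. i \<noteq> j \<Longrightarrow> A $ i $ j = 0" "A $ 1 $ 1 = A $ 2 $ 2" "A $ 2 $ 2 = A $ 3 $ 3"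
  shows "sym_part (A ** Anti n) = 0"
proof (rule sym_part_mult_Anti_eq_0I)
  fix v
  have diag: "A $ i $ i = A $ 1 $ 1" for i
    using assms(2,3) exhaust_3[of i] by auto
  have "A = mat (A $ 1 $ 1)"
    using assms(1) diag by (simp add: vec_eq_iff mat_def)
  then obtain c where "A = mat c" ..
  then have "A *v w = c *\<^sub>R w" for w
    by (simp add: matrix_vector_mult_def mat_def vec_eq_iff if_distrib[of "\<lambda>x. x * _"] cong: if_cong)
  then show "v \<bullet> (A *v cross3 n v) = 0"
    by (simp add: dot_cross_self)
qed

text \<open>In the orthonormal basis \<open>t\<close>, \<open>d = t \<times> n\<close>, \<open>n\<close> the cross product with \<open>n\<close> takes \<open>d\<close> back to
  \<open>t\<close>.  The entries \<open>(d, d)\<close> and \<open>(n, d)\<close> of the form are therefore \<open>d \<bullet> A t\<close> and \<open>n \<bullet> A t\<close>,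
  which involve only the image of \<open>t\<close>.\<close>

lemma sym_part_mult_Anti_eq_0_edge:
  assumes t: "norm t = 1" and n: "norm n = 1" and nt: "n \<bullet> t = 0"
    and cross: "\<And>w. w \<bullet> t = 0 \<Longrightarrow> w \<bullet> (A *v t) = 0"
    and "t \<bullet> (A *v cross3 n t) = 0" "n \<bullet> (A *v cross3 n t) = 0"
    and "t \<bullet> (A *v cross3 n (cross3 t n)) + cross3 t n \<bullet> (A *v cross3 n t) = 0"
  shows "sym_part (A ** Anti n) = 0"
proof (rule sym_part_mult_Anti_eq_0_basis)
  let ?d = "cross3 t n"
  have [simp]: "t \<bullet> t = 1" "n \<bullet> n = 1"
    using t n by (simp_all add: dot_square_norm)
  have [simp]: "t \<bullet> n = 0" "n \<bullet> t = 0"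
    using nt by (simp_all add: inner_commute)
  have "?d \<bullet> ?d = 1"
    by (simp add: dot_cross)
  then have "?d \<noteq> 0" "t \<noteq> 0" "n \<noteq> 0"
    using t n by (metis inner_zero_left zero_neq_one, auto)
  moreover have distinct: "t \<noteq> ?d" "t \<noteq> n" "?d \<noteq> n"
    using \<open>?d \<bullet> ?d = 1\<close> nt by (metis \<open>t \<bullet> t = 1\<close> dot_cross_self(1) zero_neq_one, auto)
       (metis \<open>n \<bullet> n = 1\<close> dot_cross_self zero_neq_one)
  ultimately have "independent {t, ?d, n}"
    by (intro pairwise_orthogonal_independent)
      (auto simp: pairwise_def orthogonal_def dot_cross_self inner_commute)
  then show "span {t, ?d, n} = UNIV"
    using card_ge_dim_independent[of "{t, ?d, n}" UNIV] distinct by auto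
  have "cross3 n ?d = t"
    by (simp add: Lagrange)
  then show "?d \<bullet> (A *v cross3 n ?d) = 0" "n \<bullet> (A *v cross3 n ?d) = 0"
    using cross[of ?d] cross[of n] by (simp_all add: dot_cross_self)
qed (use assms in auto)

section \<open>Bivariate polynomials and their zeros on a triangular lattice\<close>

text \<open>Polynomial functions of total degree at most \<open>k\<close> in two variables.  Generating them by sums
  and by products with a variable, instead of listing coefficients, makes the closure properties
  and the division below plain inductions.\<close>

inductive bipoly :: "nat \<Rightarrow> (real \<Rightarrow> real \<Rightarrow> real) \<Rightarrow> bool" where
  bipoly_const: "bipoly k (\<lambda>x y. c)"
| bipoly_add: "bipoly k f \<Longrightarrow> bipoly k g \<Longrightarrow> bipoly k (\<lambda>x y. f x y + g x y)"
| bipoly_fst: "bipoly k f \<Longrightarrow> bipoly (Suc k) (\<lambda>x y. x * f x y)"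
| bipoly_snd: "bipoly k f \<Longrightarrow> bipoly (Suc k) (\<lambda>x y. y * f x y)"

lemma bipoly_mono: "bipoly k f \<Longrightarrow> k \<le> m \<Longrightarrow> bipoly m f"
proof (induction arbitrary: m rule: bipoly.induct)
  case (bipoly_fst k f)
  then show ?case
    by (cases m) (auto intro: bipoly.intros)
next
  case (bipoly_snd k f)
  then show ?case
    by (cases m) (auto intro: bipoly.intros)
qed (auto intro: bipoly.intros)

lemma bipoly_scale: "bipoly k f \<Longrightarrow> bipoly k (\<lambda>x y. c * f x y)"
proof (induction rule: bipoly.induct)
  case (bipoly_fst k f)
  then show ?case
    using bipoly.bipoly_fst by (simp add: mult.left_commute)
next
  case (bipoly_snd k f)
  then show ?case
    using bipoly.bipoly_snd by (simp add: mult.left_commute)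
qed (auto intro: bipoly.intros simp: distrib_left)

lemma bipoly_mult:
  assumes "bipoly k f" "bipoly m g"
  shows "bipoly (k + m) (\<lambda>x y. f x y * g x y)"
  using assms(1)
proof (induction rule: bipoly.induct)
  case (bipoly_const k c)
  then show ?case
    using assms(2) by (auto intro: bipoly_scale bipoly_mono)
qed (use assms(2) in \<open>auto intro: bipoly.intros simp: distrib_right mult.assoc\<close>)

lemma bipoly_power: "bipoly 1 f \<Longrightarrow> bipoly m (\<lambda>x y. f x y ^ m)"
proof (induction m)
  case (Suc m)
  then show ?case
    using bipoly_mult[of 1 f m] by simp
qed (simp add: bipoly_const)

lemma bipoly_sum:
  "(\<And>a. a \<in> A \<Longrightarrow> bipoly k (f a)) \<Longrightarrow> bipoly k (\<lambda>x y. \<Sum>a\<in>A. f a x y)"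
  by (induction A rule: infinite_finite_induct) (auto intro: bipoly.intros)

lemma bipoly_prod:
  "(\<And>a. a \<in> A \<Longrightarrow> bipoly (d a) (f a)) \<Longrightarrow> bipoly (\<Sum>a\<in>A. d a) (\<lambda>x y. \<Prod>a\<in>A. f a x y)"
  by (induction A rule: infinite_finite_induct) (auto intro: bipoly.intros bipoly_mult)

lemma bipoly_affine: "bipoly 1 (\<lambda>x y. a + x * b + y * c)"
  using bipoly_add[OF bipoly_add[OF bipoly_const[of "Suc 0" a] bipoly_fst[OF bipoly_const[of 0 b]]]
      bipoly_snd[OF bipoly_const[of 0 c]]] by simp

text \<open>Division by \<open>y - c\<close> with a remainder that depends on \<open>x\<close> only.  In degree 0 the quotient is
  zero; this has to be said separately, because \<open>k - 1\<close> is then 0 again.\<close>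

lemma bipoly_divide:
  assumes "bipoly k f"
  shows "\<exists>p h. degree p \<le> k \<and> (k = 0 \<longrightarrow> h = (\<lambda>x y. 0)) \<and> bipoly (k - 1) h \<and>
    (\<forall>x y. f x y = poly p x + (y - c) * h x y)"
  using assms
proof (induction rule: bipoly.induct)
  case (bipoly_const k a)
  then show ?case
    by (intro exI[of _ "[:a:]"] exI[of _ "\<lambda>x y. 0"]) (auto intro: bipoly.intros)
next
  case (bipoly_add k f g)
  then obtain p q h l where
    "degree p \<le> k" "k = 0 \<longrightarrow> h = (\<lambda>x y. 0)" "bipoly (k - 1) h"
    "\<forall>x y. f x y = poly p x + (y - c) * h x y"
    "degree q \<le> k" "k = 0 \<longrightarrow> l = (\<lambda>x y. 0)" "bipoly (k - 1) l"
    "\<forall>x y. g x y = poly q x + (y - c) * l x y"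
    by metis
  then show ?case
    by (intro exI[of _ "p + q"] exI[of _ "\<lambda>x y. h x y + l x y"])
      (auto intro: bipoly.intros degree_add_le simp: algebra_simps)
next
  case (bipoly_fst k f)
  then obtain p h where h:
    "degree p \<le> k" "k = 0 \<longrightarrow> h = (\<lambda>x y. 0)" "bipoly (k - 1) h"
    "\<forall>x y. f x y = poly p x + (y - c) * h x y"
    by metis
  have "bipoly k (\<lambda>x y. x * h x y)"
    using h bipoly.bipoly_fst[OF h(3)] by (cases k) (auto intro: bipoly.intros)
  with h show ?case
    by (intro exI[of _ "pCons 0 p"] exI[of _ "\<lambda>x y. x * h x y"])
      (auto simp: distrib_left mult.left_commute intro: order_trans[OF degree_pCons_le])
next
  case (bipoly_snd k f)
  then obtain p h where h:
    "degree p \<le> k" "k = 0 \<longrightarrow> h = (\<lambda>x y. 0)" "bipoly (k - 1) h"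
    "\<forall>x y. f x y = poly p x + (y - c) * h x y"
    by metis
  \<comment> \<open>Write \<open>y f = (y - c) f + c f\<close> and divide the second \<open>f\<close> only.\<close>
  have "y * f x y = poly (smult c p) x + (y - c) * (f x y + c * h x y)" for x y
    unfolding h(4)[rule_format] poly_smult by (simp add: algebra_simps)
  moreover have "bipoly k (\<lambda>x y. f x y + c * h x y)"
    using bipoly_snd.hyps h(3) by (auto intro!: bipoly.intros(2) bipoly_scale intro: bipoly_mono)
  ultimately show ?case
    using h(1) by (intro exI[of _ "smult c p"] exI[of _ "\<lambda>x y. f x y + c * h x y"]) auto
qed

text \<open>The remainder of the division is the restriction to the line \<open>y = c\<close>.  It has degree at most
  \<open>k\<close> and \<open>k + 1\<close> zeros, so it is zero.\<close>

lemma bipoly_divide_line: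
  assumes "bipoly k f" "inj_on X {..k}" "\<And>i. i \<le> k \<Longrightarrow> f (X i) c = 0"
  obtains h where "bipoly (k - 1) h" "k = 0 \<Longrightarrow> h = (\<lambda>x y. 0)"
    "\<And>x y. f x y = (y - c) * h x y"
proof -
  obtain p h where h: "degree p \<le> k" "k = 0 \<longrightarrow> h = (\<lambda>x y. 0)" "bipoly (k - 1) h"
    "\<And>x y. f x y = poly p x + (y - c) * h x y"
    using bipoly_divide[OF assms(1), of c] by metis
  have "p = 0"
  proof (rule poly_eqI_degree)
    show "poly p x = poly 0 x" if "x \<in> X ` {..k}" for x
      using that assms(3) h(4)[of x c] by auto
  qed (use h(1) card_image[OF assms(2)] in auto)
  then show thesis
    using h that by auto
qed

text \<open>The nodes are arbitrary because the induction removes the line \<open>y = Y 0\<close>: what remains is a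
  lattice of order \<open>k - 1\<close> with the nodes \<open>Y 1, \<dots>, Y k\<close>.\<close>

lemma bipoly_unisolvence:
  assumes "bipoly k f" "inj_on X {..k}" "inj_on Y {..k}"
    and "\<And>i j. i + j \<le> k \<Longrightarrow> f (X i) (Y j) = 0"
  shows "f x y = 0"
  using assms
proof (induction k arbitrary: f Y y)
  case 0
  then show ?case
    using bipoly_divide_line[OF 0(1), of X "Y 0"] by auto
next
  case (Suc k)
  obtain h where h: "bipoly k h" "f x y = (y - Y 0) * h x y" for x y
    using bipoly_divide_line[OF Suc.prems(1), of X "Y 0"] Suc.prems(2,4) by auto
  have "h x y = 0"
  proof (rule Suc.IH[OF h(1), of "Y \<circ> Suc"])
    show "inj_on X {..k}"
      using Suc.prems(2) by (rule inj_on_subset) auto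
    show "inj_on (Y \<circ> Suc) {..k}"
      using Suc.prems(3) by (auto simp: inj_on_def)
    show "h (X i) ((Y \<circ> Suc) j) = 0" if "i + j \<le> k" for i j
    proof -
      have "Y (Suc j) \<noteq> Y 0"
        using Suc.prems(3) that by (auto dest: inj_onD)
      then show ?thesis
        using Suc.prems(4)[of i "Suc j"] h(2)[of "X i" "Y (Suc j)"] that by auto
    qed
  qed
  then show ?case
    by (simp add: h(2))
qed

section \<open>Lagrange points, edges and faces of a simplex\<close>

text \<open>Dropping the zero weights leaves a convex combination of affinely independent points with
  positive weights only, and these combinations form the relative interior.\<close>

lemma lagrange_point_in_rel_interior_support:
  fixes C :: "(real^3) set" and m :: "real^3 \<Rightarrow> nat"
  assumes C: "\<not> affine_dependent C"
    and k: "(\<Sum>v\<in>C. m v) = k" "k > 0"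
  shows "(\<Sum>v\<in>C. (m v / k) *\<^sub>R v) \<in>
    inner_lagrange_points k (convex hull C) (convex hull {v \<in> C. m v > 0})"
proof -
  let ?S = "{v \<in> C. m v > 0}"
  let ?L = "\<Sum>v\<in>C. (m v / k) *\<^sub>R v"
  have fin: "finite C"
    using C aff_independent_finite by blast
  have sum1: "(\<Sum>v\<in>C. m v / k) = 1"
    using k by (simp flip: sum_divide_distrib of_nat_sum)
  have "{v. v extreme_point_of convex hull C} = C"
    using C by (simp add: extreme_point_of_convex_hull_affine_independent)
  then have "?L \<in> lagrange_points k (convex hull C)"
    unfolding lagrange_points_def using sum1 by (auto intro!: exI[of _ "\<lambda>v. m v / k"])
  moreover have "(\<Sum>v\<in>?S. m v / k) = 1" "(\<Sum>v\<in>?S. (m v / k) *\<^sub>R v) = ?L"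
    using fin sum1 by (auto simp flip: sum1 intro!: sum.mono_neutral_left)
  then have "?L \<in> rel_interior (convex hull ?S)"
    using \<open>k > 0\<close> affine_independent_subset[OF C, of ?S]
    by (subst rel_interior_convex_hull_explicit) (auto intro!: exI[of _ "\<lambda>v. m v / k"])
  ultimately show ?thesis
    by (simp add: inner_lagrange_points_def)
qed

lemma tangent_space_segment: "tangent_space (convex hull {p, q}) = span {q - p}"
proof
  have "x - y \<in> span {q - p}" if "x \<in> convex hull {p, q}" "y \<in> convex hull {p, q}" for x y
  proof -
    obtain a b where "x = p + a *\<^sub>R (q - p)" "y = p + b *\<^sub>R (q - p)"
      using \<open>x \<in> _\<close> \<open>y \<in> _\<close> unfolding convex_hull_2_alt by blast
    then have "x - y = (a - b) *\<^sub>R (q - p)"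
      by (simp add: scaleR_left_diff_distrib)
    then show ?thesis
      by (simp add: span_base span_scale)
  qed
  then show "tangent_space (convex hull {p, q}) \<subseteq> span {q - p}"
    unfolding tangent_space_def by (intro span_minimal) auto
  show "span {q - p} \<subseteq> tangent_space (convex hull {p, q})"
    unfolding tangent_space_def by (intro span_mono) (auto intro!: hull_inc)
qed

lemma orthogonal_space_iff: "w \<in> orthogonal_space S \<longleftrightarrow> (\<forall>v\<in>tangent_space S. w \<bullet> v = 0)"
proof
  assume w: "w \<in> orthogonal_space S"
  show "\<forall>v\<in>tangent_space S. w \<bullet> v = 0"
  proof
    fix v assume "v \<in> tangent_space S"
    then show "w \<bullet> v = 0"
      unfolding tangent_space_def
      by (induction rule: span_induct_alt)
        (use w in \<open>auto simp: orthogonal_space_def inner_add_right\<close>)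
  qed
qed (auto simp: orthogonal_space_def tangent_space_def intro!: span_base)

text \<open>An edge has a one-dimensional tangent space, so a single tangent vector decides
  orthogonality to the edge.\<close>

lemma orthogonal_to_edge_tangent:
  assumes "t \<in> tangent_space (convex hull {p, q})" "t \<noteq> 0" "w \<bullet> t = 0"
  shows "w \<in> orthogonal_space (convex hull {p, q})"
proof -
  obtain c where "t = c *\<^sub>R (q - p)"
    using assms(1) by (auto simp: tangent_space_segment span_singleton)
  then have "w \<bullet> (q - p) = 0"
    using assms(2,3) by auto
  then show ?thesis
    by (auto simp: orthogonal_space_iff tangent_space_segment span_singleton)
qed

lemma span_pair_inner_eq_0:
  assumes "w \<in> span {a, b}" "a \<bullet> z = 0" "b \<bullet> z = 0"
  shows "w \<bullet> z = 0"
  using assms(1) by (induction rule: span_induct_alt) (use assms(2,3) in \<open>auto simp: inner_add_left\<close>)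

text \<open>The smallest face containing a lattice point of the triangle \<open>p q r\<close>.  Its number of vertices
  is at most \<open>k\<close>, since the numerators of the weights there are positive and have sum \<open>k\<close>; so
  an edge occurs only for \<open>k \<ge> 2\<close> and the whole triangle only for \<open>k \<ge> 3\<close>.\<close>

lemma lattice_point_of_face:
  fixes p q r :: "real^3" and i j :: nat
  assumes C: "\<not> affine_dependent C" "{p, q, r} \<subseteq> C" and distinct: "p \<noteq> q" "q \<noteq> r" "p \<noteq> r"
    and k: "k > 0" "i + j \<le> k"
  obtains S where "S \<subseteq> {p, q, r}" "S \<noteq> {}" "card S \<le> k"
    "p + (i / k) *\<^sub>R (q - p) + (j / k) *\<^sub>R (r - p) \<in>
      inner_lagrange_points k (convex hull C) (convex hull S)"
proof -
  define m where "m v = (if v = p then k - (i + j) else if v = q then i else if v = r then j else 0)"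
    for v
  let ?S = "{v \<in> C. m v > 0}"
  have fin: "finite C"
    using C(1) aff_independent_finite by blast
  have m: "m p = k - (i + j)" "m q = i" "m r = j" "\<And>v. v \<notin> {p, q, r} \<Longrightarrow> m v = 0"
    using distinct by (auto simp: m_def)
  have "sum m C = sum m {p, q, r}"
    using C(2) fin m(4) by (intro sum.mono_neutral_right) auto
  then have sum_m: "sum m C = k"
    using distinct m k(2) by simp
  have "(\<Sum>v\<in>C. (m v / k) *\<^sub>R v) = (\<Sum>v\<in>{p, q, r}. (m v / k) *\<^sub>R v)"
    using C(2) fin m(4) by (intro sum.mono_neutral_right) auto
  also have "\<dots> = (1 - i / k - j / k) *\<^sub>R p + (i / k) *\<^sub>R q + (j / k) *\<^sub>R r"
    using distinct m k by (simp add: of_nat_diff diff_divide_distrib add_divide_distrib algebra_simps)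
  also have "\<dots> = p + (i / k) *\<^sub>R (q - p) + (j / k) *\<^sub>R (r - p)"
    by (simp add: algebra_simps)
  finally have point: "p + (i / k) *\<^sub>R (q - p) + (j / k) *\<^sub>R (r - p) \<in>
      inner_lagrange_points k (convex hull C) (convex hull ?S)"
    using lagrange_point_in_rel_interior_support[OF C(1) sum_m k(1)] by simp
  have "card ?S = (\<Sum>v\<in>?S. 1)"
    by simp
  also have "\<dots> \<le> sum m ?S"
    by (rule sum_mono) auto
  also have "\<dots> \<le> sum m C"
    using fin by (intro sum_mono2) auto
  finally have "card ?S \<le> k"
    by (simp add: sum_m)
  moreover have "?S \<noteq> {}"
    using sum_m k(1) by (metis (mono_tags, lifting) empty_iff mem_Collect_eq not_gr_zero sum.neutral)
  moreover have "?S \<subseteq> {p, q, r}"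
    using m(4) by force
  ultimately show thesis
    using point that by blast
qed

section \<open>Vanishing on a face\<close>

lemma matrix_polys_bipoly:
  assumes "U \<in> matrix_polys k T"
  obtains P where "\<And>i j. bipoly k (P i j)"
    "\<And>i j x y. p + x *\<^sub>R (q - p) + y *\<^sub>R (r - p) \<in> T \<Longrightarrow>
      P i j x y = U (p + x *\<^sub>R (q - p) + y *\<^sub>R (r - p)) $ i $ j"
proof -
  obtain c where c: "\<And>i j x. x \<in> T \<Longrightarrow>
      U x $ i $ j = (\<Sum>\<alpha>\<in>multi_indices k. c i j \<alpha> * (\<Prod>l\<in>UNIV. (x $ l) ^ \<alpha> l))"
    using assms unfolding matrix_polys_def by simp metis
  let ?P = "\<lambda>i j x y. \<Sum>\<alpha>\<in>multi_indices k. c i j \<alpha> *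
      (\<Prod>l\<in>UNIV. (p $ l + x * (q - p) $ l + y * (r - p) $ l) ^ \<alpha> l)"
  show thesis
  proof (rule that[of ?P])
    show "bipoly k (?P i j)" for i j
    proof (intro bipoly_sum bipoly_scale)
      fix \<alpha> assume "\<alpha> \<in> multi_indices k"
      then have "(\<Sum>l\<in>UNIV. \<alpha> l) \<le> k"
        by (simp add: multi_indices_def)
      moreover have "bipoly (\<Sum>l\<in>UNIV. \<alpha> l)
          (\<lambda>x y. \<Prod>l\<in>UNIV. (p $ l + x * (q - p) $ l + y * (r - p) $ l) ^ \<alpha> l)"
        by (intro bipoly_prod bipoly_power bipoly_affine)
      ultimately show "bipoly k
          (\<lambda>x y. \<Prod>l\<in>UNIV. (p $ l + x * (q - p) $ l + y * (r - p) $ l) ^ \<alpha> l)"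
        using bipoly_mono by blast
    qed
  qed (simp add: c)
qed

text \<open>For a constant matrix \<open>N\<close> the entries of \<open>sym (U N)\<close> are linear combinations of those of \<open>U\<close>, so
  along an affine parametrisation of the triangle they are again polynomials of degree at most \<open>k\<close>.\<close>

lemma sym_part_mult_vanishes_on_triangle:
  fixes p q r :: "real^3"
  assumes U: "U \<in> matrix_polys k T" and k: "k \<ge> 1" and sub: "convex hull {p, q, r} \<subseteq> T"
    and lattice: "\<And>i j :: nat. i + j \<le> k \<Longrightarrow>
      sym_part (U (p + (i / k) *\<^sub>R (q - p) + (j / k) *\<^sub>R (r - p)) ** N) = 0"
    and z: "z \<in> convex hull {p, q, r}"
  shows "sym_part (U z ** N) = 0"
proof -
  define \<phi> where "\<phi> x y = p + x *\<^sub>R (q - p) + y *\<^sub>R (r - p)" for x y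
  obtain P where P: "\<And>i j. bipoly k (P i j)"
    "\<And>i j x y. \<phi> x y \<in> T \<Longrightarrow> P i j x y = U (\<phi> x y) $ i $ j"
    using matrix_polys_bipoly[OF U, of p q r] unfolding \<phi>_def by metis
  \<comment> \<open>Twice the entries of \<open>sym (U N)\<close>, continued from \<open>T\<close> to the whole plane of the triangle.\<close>
  define Q where "Q i j x y =
      (\<Sum>l\<in>UNIV. N $ l $ j * P i l x y) + (\<Sum>l\<in>UNIV. N $ l $ i * P j l x y)"
    for i j x y
  have Q: "Q i j x y = 2 * sym_part (U (\<phi> x y) ** N) $ i $ j" if "\<phi> x y \<in> T" for i j x y
    by (simp add: Q_def P(2)[OF that] sym_part_def transpose_def matrix_matrix_mult_def mult.commute)
  have in_T: "\<phi> x y \<in> T" if "0 \<le> x" "0 \<le> y" "x + y \<le> 1" for x y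
    using that sub unfolding convex_hull_3_alt \<phi>_def by blast
  have nodes: "inj_on (\<lambda>i. real i / k) {..k}"
    using k by (auto simp: inj_on_def)
  have "Q i j x y = 0" for i j x y
  proof (rule bipoly_unisolvence[where f = "Q i j", OF _ nodes nodes])
    show "bipoly k (Q i j)"
      unfolding Q_def by (intro bipoly_add bipoly_sum bipoly_scale P(1))
    show "Q i j (a / k) (b / k) = 0" if "a + b \<le> k" for a b :: nat
    proof -
      have "\<phi> (a / k) (b / k) \<in> T"
        using that k by (intro in_T) (auto simp flip: add_divide_distrib of_nat_add)
      then show ?thesis
        using lattice[OF that] by (simp add: Q flip: \<phi>_def)
    qed
  qed
  moreover obtain x y where z_eq: "z = \<phi> x y"
    using z unfolding convex_hull_3_alt \<phi>_def by blast
  moreover have "\<phi> x y \<in> T"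
    using z sub z_eq by blast
  ultimately show ?thesis
    unfolding z_eq vec_eq_iff using Q by simp
qed

theorem theorem10:
  fixes T F :: "(real^3) set"
    and k :: nat
    and U :: "real^3 \<Rightarrow> real^3^3"
    and n a1 a2 :: "real^3"
    and t n1 n2 :: "(real^3) set \<Rightarrow> real^3"
  assumes tetrahedron: "3 simplex T"
    and degree: "k \<ge> 1"
    and face: "F facet_of T"
    and normal: "norm n = 1" "n \<in> orthogonal_space F"
    and edge_tangent: "\<And>E. E edge_of T \<Longrightarrow> norm (t E) = 1 \<and> t E \<in> tangent_space E"
    and edge_normals: "\<And>E. E edge_of T \<Longrightarrow> norm (n1 E) = 1 \<and> norm (n2 E) = 1 \<and>
      span {n1 E, n2 E} = orthogonal_space E"
    and face_vectors: "distinct [a1, a2, n]" "independent {a1, a2, n}"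
    and polynomial: "U \<in> matrix_polys k T"
    and dof_1a: "\<And>V i j. V extreme_point_of F \<Longrightarrow> i \<noteq> j \<Longrightarrow> U V $ i $ j = 0"
    and dof_1b: "\<And>V. V extreme_point_of F \<Longrightarrow>
      U V $ 1 $ 1 - U V $ 2 $ 2 = 0 \<and> U V $ 2 $ 2 - U V $ 3 $ 3 = 0"
    and dof_2a: "\<And>E L. k \<ge> 2 \<Longrightarrow> E edge_of F \<Longrightarrow> L \<in> inner_lagrange_points k T E \<Longrightarrow>
      n1 E \<bullet> (U L *v t E) = 0 \<and> n2 E \<bullet> (U L *v t E) = 0"
    and dof_2b: "\<And>E L d. k \<ge> 2 \<Longrightarrow> E edge_of F \<Longrightarrow> L \<in> inner_lagrange_points k T E \<Longrightarrow>
      d = cross3 (t E) n \<Longrightarrow>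
      t E \<bullet> (U L *v cross3 n (t E)) = 0 \<and>
      n \<bullet> (U L *v cross3 n (t E)) = 0 \<and>
      t E \<bullet> (U L *v cross3 n d) + d \<bullet> (U L *v cross3 n (t E)) = 0"
    and dof_3a: "\<And>L. k \<ge> 3 \<Longrightarrow> L \<in> inner_lagrange_points k T F \<Longrightarrow>
      a1 \<bullet> (U L *v cross3 n a1) = 0 \<and>
      a2 \<bullet> (U L *v cross3 n a2) = 0 \<and>
      a1 \<bullet> (U L *v cross3 n a2) + a2 \<bullet> (U L *v cross3 n a1) = 0 \<and>
      n \<bullet> (U L *v cross3 n a1) = 0 \<and>
      n \<bullet> (U L *v cross3 n a2) = 0"
  shows "\<forall>x\<in>F. sym_part (U x ** Anti n) = 0"
proof -
  obtain C where C: "\<not> affine_dependent C" "card C = 4" "T = convex hull C"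
    using tetrahedron by (auto simp: simplex_def)
  obtain u where u: "u \<in> C" "F = convex hull (C - {u})"
    using face unfolding C(3) facet_of_convex_hull_affine_independent[OF C(1)] by blast
  have "card (C - {u}) = 3"
    using C(2) u(1) by simp
  then obtain p q r where pqr: "C - {u} = {p, q, r}" "p \<noteq> q" "q \<noteq> r" "p \<noteq> r"
    by (auto simp: card_3_iff)
  have F: "F = convex hull {p, q, r}" and sub: "{p, q, r} \<subseteq> C"
    using u(2) pqr(1) by auto
  have indep: "\<not> affine_dependent {p, q, r}"
    using C(1) sub affine_independent_subset by blast
  \<comment> \<open>The face spanned by \<open>S\<close> is a vertex, an edge or \<open>F\<close> itself.\<close>
  have vanish: "sym_part (U L ** Anti n) = 0"
    if S: "S \<subseteq> {p, q, r}" "S \<noteq> {}" "card S \<le> k"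
      and L: "L \<in> inner_lagrange_points k T (convex hull S)" for S L
  proof -
    have "card S \<le> card {p, q, r}"
      using S(1) by (intro card_mono) auto
    moreover have "card S \<noteq> 0"
      using S(1,2) finite_subset[OF S(1)] by simp
    ultimately consider "card S = 1" | "card S = 2" | "card S = 3"
      using pqr(2-4) by force
    then show ?thesis
    proof cases
      case 1
      then obtain V where V: "S = {V}"
        by (auto simp: card_1_singleton_iff)
      then have "L = V"
        using L by (simp add: inner_lagrange_points_def)
      moreover have "V extreme_point_of F"
        using S(1) V unfolding F extreme_point_of_convex_hull_affine_independent[OF indep] by simp
      ultimately show ?thesis
        using dof_1a dof_1b[of V] by (intro sym_part_mult_Anti_eq_0_scalar) auto
    next
      case 2
      then obtain a b where ab: "S = {a, b}" "a \<noteq> b"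
        by (auto simp: card_2_iff)
      let ?E = "convex hull {a, b}"
      have "?E face_of F"
        using S(1) ab unfolding F face_of_convex_hull_affine_independent[OF indep] by blast
      then have E: "?E edge_of F"
        using ab(2) by (simp add: edge_of_def aff_dim_convex_hull aff_dim_2)
      then have "?E edge_of T"
        using face by (auto simp: edge_of_def facet_of_def intro: face_of_trans)
      note tangent = edge_tangent[OF this] and normals = edge_normals[OF this]
      have "t ?E \<noteq> 0"
        using tangent by (metis norm_zero zero_neq_one)
      have "?E \<subseteq> F"
        using E by (rule edge_of_imp_subset)
      then have "n \<in> orthogonal_space ?E"
        using normal(2) by (auto simp: orthogonal_space_def)
      then have "n \<bullet> t ?E = 0"
        using tangent by (simp add: orthogonal_space_iff)
      moreover have "w \<bullet> (U L *v t ?E) = 0" if "w \<bullet> t ?E = 0" for w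
      proof (rule span_pair_inner_eq_0)
        show "w \<in> span {n1 ?E, n2 ?E}"
          using orthogonal_to_edge_tangent[of "t ?E" a b w] \<open>t ?E \<noteq> 0\<close> tangent normals that
          by auto
      qed (use dof_2a[OF _ E] L ab S(3) 2 in auto)
      ultimately show ?thesis
        using dof_2b[OF _ E _ refl, of L] L ab S(3) 2 tangent normal(1)
        by (intro sym_part_mult_Anti_eq_0_edge) auto
    next
      case 3
      then have "S = {p, q, r}"
        using S(1) pqr by (intro card_subset_eq) auto
      moreover have "span {a1, a2, n} = UNIV"
        using card_ge_dim_independent[of "{a1, a2, n}" UNIV] face_vectors by auto
      ultimately show ?thesis
        using dof_3a[of L] S(3) 3 L F by (intro sym_part_mult_Anti_eq_0_basis) auto
    qed
  qed
  show ?thesis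
  proof
    fix x assume "x \<in> F"
    show "sym_part (U x ** Anti n) = 0"
    proof (rule sym_part_mult_vanishes_on_triangle[OF polynomial degree])
      show "convex hull {p, q, r} \<subseteq> T"
        using face facet_of_imp_subset F by blast
      show "x \<in> convex hull {p, q, r}"
        using \<open>x \<in> F\<close> F by simp
      show "sym_part (U (p + (i / k) *\<^sub>R (q - p) + (j / k) *\<^sub>R (r - p)) ** Anti n) = 0"
        if ij: "i + j \<le> k" for i j :: nat
      proof -
        have "k > 0"
          using degree by simp
        from lattice_point_of_face[OF C(1) sub pqr(2-4) this ij] show ?thesis
          using vanish C(3) by metis
      qed
    qed
  qed
qed

end
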